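(* Let $A\in\mathbb{R}_{\max}^{p\times n}$, $B\in\mathbb{G}^{p\times n}$, $\mathbf{c}\in\mathbb{R}_{\max}^p$, $\mathbf{d}\in\mathbb{G}^p$, $g\in\mathbb{R}_{\max}$, $h\in\mathbb{G}\setminus\{+\infty\}$, and let $\mathbf{e}$ and $\mathbf{f}$ be $n$-dimensional row vectors with entries in $\mathbb{R}_{\max}$ and $\mathbb{G}$ respectively, such that $(\mathbf{e},g)$ is not identically $-\infty$. Let $\mathbf{v}=(\mathbf{e},g,\mathbf{f},h)$, a row vector of dimension $2n+2$, and let $R\in\mathbb{G}^{p\times(2n+2)}$ be the matrix whose $i$-th row is $(A_i,\mathbf{c}_i,B_i,\mathbf{d}_i)$, where $A_i,B_i$ are the $i$-th rows of $A,B$; assume that no row of $R$ is identically $-\infty$. Define the $p$-dimensional row vector $\mathbf{w}^*$ by $$\mathbf{w}^*_i=\min_{1\leq j\leq 2n+2}(\mathbf{v}_j/R_{ij}),\qquad 1\le i\le p .$$ Then the inequality $\mathbf{e}\mathbf{x}\oplus g\leq_{\mathbb{G}}\mathbf{f}\mathbf{x}\oplus h$ is a linear combination of the inequalities in the system $A\mathbf{x}\oplus\mathbf{c}\leq_{\mathbb{G}}B\mathbf{x}\oplus\mathbf{d}$ if, and only if, $\mathbf{v}=\mathbf{w}^*R$.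
   Context: $\mathbb{R}_{\max}=\mathbb{R}\cup\{-\infty\}$ is the max-plus semiring ($x\oplus y=\max(x,y)$, $x\otimes y=xy=x+y$), and $\overline{\mathbb{R}}_{\max}=\mathbb{R}_{\max}\cup\{+\infty\}$. Let $\mathbb{R}^-=\{\alpha^-:\alpha\in\mathbb{R}\}$ be a disjoint copy of $\mathbb{R}$ and $\mathbb{G}=\overline{\mathbb{R}}_{\max}\cup\mathbb{R}^-$. The modulus is $|x|=x$ for $x\in\overline{\mathbb{R}}_{\max}$ and $|\alpha^-|=\alpha$. The total order $\leq_{\mathbb{G}}$ is: $x\leq_{\mathbb{G}}y$ iff $|x|<|y|$ when $x\in\overline{\mathbb{R}}_{\max}$ and $y\in\mathbb{R}^-$, and $|x|\le|y|$ in all other cases. $\mathbb{G}$ is a semiring where $x\oplus y$ is the greater of $x,y$ for $\leq_{\mathbb{G}}$, and $xy$ is: $x+y$ if $x,y\in\mathbb{R}$; $(|x|+|y|)^-$ if $x\in\mathbb{R}^-$ or $y\in\mathbb{R}^-$ and both are different from $\pm\infty$; $-\infty$ if $x=-\infty$ or $y=-\infty$; $+\infty$ if neither is $-\infty$ and at least one is $+\infty$. Matrix operations use these operations. For $x,y\in\mathbb{G}$, $y/x$ denotes the maximal element of $\{z\in\mathbb{G}: zx\leq_{\mathbb{G}}y\}$; explicitly $y/x=(|y|-|x|)^-$ if $x\in\mathbb{R}$ and $y\in\mathbb{R}^-$, and $y/x=|y|-|x|$ otherwise, with the conventions $\alpha-(-\infty)=+\infty$ for $\alpha\in\overline{\mathbb{R}}_{\max}$,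 $\alpha-(+\infty)=-\infty$ for $\alpha\in\mathbb{R}_{\max}$, and $(+\infty)-(+\infty)=+\infty$. The minimum is taken with respect to $\leq_{\mathbb{G}}$. The inequality represented by $\mathbf{v}$ is a linear combination of the inequalities of the system if there exists a $p$-dimensional row vector $\mathbf{w}$ with entries in $\mathbb{G}$ such that $\mathbf{v}=\mathbf{w}R$. *)

theory Defs
  imports "Jordan_Normal_Form.Matrix" "HOL-Library.Extended_Real"
begin

section \<open>The semiring \<open>\<G>\<close>\<close>

(* Fin a is the real number a, Neg a is its copy written with superscript minus. *)
datatype gsemi = MInf | Fin real | Neg real | PInf

definition Rmax :: "gsemi set" where
  "Rmax = insert MInf (range Fin)"

definition Rmax_bar :: "gsemi set" where
  "Rmax_bar = insert PInf Rmax"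

definition Rneg :: "gsemi set" where
  "Rneg = range Neg"

fun modulus :: "gsemi \<Rightarrow> ereal" where
  "modulus MInf = -\<infinity>"
| "modulus (Fin a) = ereal a"
| "modulus (Neg a) = ereal a"
| "modulus PInf = \<infinity>"

instantiation gsemi :: linorder
begin

definition less_eq_gsemi :: "gsemi \<Rightarrow> gsemi \<Rightarrow> bool" where
  "x \<le> y \<longleftrightarrow>
     (if x \<in> Rmax_bar \<and> y \<in> Rneg then modulus x < modulus y else modulus x \<le> modulus y)"

definition less_gsemi :: "gsemi \<Rightarrow> gsemi \<Rightarrow> bool" where
  "x < y \<longleftrightarrow> x \<le> y \<and> \<not> y \<le> (x :: gsemi)"

lemma le_gsemi_simps [simp]:
  "MInf \<le> y"
  "x \<le> PInf"
  "Fin a \<le> MInf \<longleftrightarrow> False"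
  "Neg a \<le> MInf \<longleftrightarrow> False"
  "PInf \<le> MInf \<longleftrightarrow> False"
  "PInf \<le> Fin a \<longleftrightarrow> False"
  "PInf \<le> Neg a \<longleftrightarrow> False"
  "Fin a \<le> Fin b \<longleftrightarrow> a \<le> b"
  "Fin a \<le> Neg b \<longleftrightarrow> a < b"
  "Neg a \<le> Fin b \<longleftrightarrow> a \<le> b"
  "Neg a \<le> Neg b \<longleftrightarrow> a \<le> b"
  by (cases y; cases x; auto simp: less_eq_gsemi_def Rmax_bar_def Rmax_def Rneg_def)+

instance
proof
  fix x y z :: gsemi
  show "x < y \<longleftrightarrow> x \<le> y \<and> \<not> y \<le> x" by (rule less_gsemi_def)
  show "x \<le> x" by (cases x) auto
  show "x \<le> y \<Longrightarrow> y \<le> z \<Longrightarrow> x \<le> z" by (cases x; cases y; cases z) auto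
  show "x \<le> y \<Longrightarrow> y \<le> x \<Longrightarrow> x = y" by (cases x; cases y) auto
  show "x \<le> y \<or> y \<le> x" by (cases x; cases y) auto
qed

end

instantiation gsemi :: comm_semiring_1
begin

definition zero_gsemi :: gsemi where "0 = MInf"

definition one_gsemi :: gsemi where "1 = Fin 0"

definition plus_gsemi :: "gsemi \<Rightarrow> gsemi \<Rightarrow> gsemi" where
  "x + y = max x (y :: gsemi)"

fun times_gsemi :: "gsemi \<Rightarrow> gsemi \<Rightarrow> gsemi" where
  "MInf * y = MInf"
| "x * MInf = MInf"
| "PInf * y = PInf"
| "x * PInf = PInf"
| "Fin a * Fin b = Fin (a + b)"
| "Fin a * Neg b = Neg (a + b)"
| "Neg a * Fin b = Neg (a + b)"
| "Neg a * Neg b = Neg (a + b)"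

lemma times_gsemi_mono: "x \<le> y \<Longrightarrow> x * z \<le> y * (z :: gsemi)"
  by (cases x; cases y; cases z) auto

instance
proof
  fix a b c :: gsemi
  show "a + b + c = a + (b + c)" "a + b = b + a" "0 + a = a"
    by (auto simp: plus_gsemi_def zero_gsemi_def max_def)
  show "a * b * c = a * (b * c)" by (cases a; cases b; cases c) auto
  show "a * b = b * a" by (cases a; cases b) auto
  show "1 * a = a" by (cases a) (auto simp: one_gsemi_def)
  show "(a + b) * c = a * c + b * c"
    using times_gsemi_mono[of a b c] times_gsemi_mono[of b a c]
    by (auto simp: plus_gsemi_def max_def)
  show "0 * a = 0" "a * 0 = 0" by (cases a; simp add: zero_gsemi_def)+
  show "(0 :: gsemi) \<noteq> 1" by (simp add: zero_gsemi_def one_gsemi_def)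
qed

end

section \<open>Residuation\<close>

definition gdiv :: "gsemi \<Rightarrow> gsemi \<Rightarrow> gsemi" (infixl \<open>\<oslash>\<close> 70) where
  "y \<oslash> x = (GREATEST z. z * x \<le> y)"

fun gdiv_explicit :: "gsemi \<Rightarrow> gsemi \<Rightarrow> gsemi" where
  "gdiv_explicit y MInf = PInf"
| "gdiv_explicit PInf x = PInf"
| "gdiv_explicit y PInf = MInf"
| "gdiv_explicit MInf x = MInf"
| "gdiv_explicit (Neg b) (Fin a) = Neg (b - a)"
| "gdiv_explicit (Fin b) (Fin a) = Fin (b - a)"
| "gdiv_explicit (Fin b) (Neg a) = Fin (b - a)"
| "gdiv_explicit (Neg b) (Neg a) = Fin (b - a)"

lemma times_le_iff_le_gdiv_explicit: "z * x \<le> y \<longleftrightarrow> z \<le> gdiv_explicit y x"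
  by (cases x; cases y; cases z) auto

(* The greatest element in the definition of gdiv always exists. *)
lemma gdiv_eq_explicit: "y \<oslash> x = gdiv_explicit y x"
  unfolding gdiv_def times_le_iff_le_gdiv_explicit by (rule Greatest_equality) auto

section \<open>Inequalities and linear combinations\<close>

(* The coefficient row of the inequality a x + b \<le> a' x + b', with unknown x. *)
definition ineq_row :: "gsemi vec \<Rightarrow> gsemi \<Rightarrow> gsemi vec \<Rightarrow> gsemi \<Rightarrow> gsemi vec" where
  "ineq_row a b a' b' = a @\<^sub>v vCons b (a' @\<^sub>v vCons b' vNil)"

definition system_mat ::
    "gsemi mat \<Rightarrow> gsemi vec \<Rightarrow> gsemi mat \<Rightarrow> gsemi vec \<Rightarrow> gsemi mat" where
  "system_mat A c B d =
     mat_of_rows (2 * dim_col A + 2)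
       (map (\<lambda>i. ineq_row (row A i) (c $ i) (row B i) (d $ i)) [0..<dim_row A])"

definition row_times_mat :: "'a :: semiring_0 vec \<Rightarrow> 'a mat \<Rightarrow> 'a vec" (infixl \<open>\<^sub>v*\<close> 70) where
  "w \<^sub>v* R = vec (dim_col R) (\<lambda>j. w \<bullet> col R j)"

definition is_linear_combination :: "gsemi vec \<Rightarrow> gsemi mat \<Rightarrow> bool" where
  "is_linear_combination v R \<longleftrightarrow> (\<exists>w \<in> carrier_vec (dim_row R). v = w \<^sub>v* R)"

definition w_star :: "gsemi vec \<Rightarrow> gsemi mat \<Rightarrow> gsemi vec" where
  "w_star v R = vec (dim_row R) (\<lambda>i. Min ((\<lambda>j. v $ j \<oslash> R $$ (i, j)) ` {..<dim_vec v}))"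

end

theory Submission
  imports Defs
begin

text \<open>
  Right multiplication by \<open>R\<close> is residuated: \<open>w R \<le> v\<close> holds entrywise if and only if
  \<open>w \<le> w\<^sup>*\<close> entrywise. Hence \<open>w\<^sup>* R\<close> is the largest combination of the rows
  of \<open>R\<close> below \<open>v\<close>, and it equals \<open>v\<close> as soon as some combination does.
\<close>

lemma times_le_iff_le_gdiv: "z * x \<le> y \<longleftrightarrow> z \<le> y \<oslash> x"
  by (simp add: gdiv_eq_explicit times_le_iff_le_gdiv_explicit)

text \<open>Addition is the maximum and the empty sum is \<open>MInf\<close>, the least element, so
  a finite sum is a supremum even when \<open>S\<close> is empty.\<close>

lemma sum_gsemi_le_iff:
  fixes F :: "'a \<Rightarrow> gsemi"
  assumes "finite S"
  shows "sum F S \<le> y \<longleftrightarrow> (\<forall>i\<in>S. F i \<le> y)"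
  using assms by induction (auto simp: zero_gsemi_def plus_gsemi_def)

lemma index_row_times_mat:
  assumes "j < dim_col R"
  shows "(w \<^sub>v* R) $ j = (\<Sum>i<dim_row R. w $ i * R $$ (i, j))"
  using assms by (simp add: row_times_mat_def scalar_prod_def atLeast0LessThan)

text \<open>An entry of the product is a supremum over rows, so each side unfolds to one condition
  per pair \<open>(i, j)\<close>; \<open>\<oslash>\<close> moves the factor
  \<open>R $$ (i, j)\<close> across, and the bounds for fixed \<open>i\<close> combine into their
  minimum.\<close>

lemma row_times_mat_le_iff_le_w_star:
  assumes "dim_vec v = dim_col R" and "dim_col R > 0"
  shows "(\<forall>j<dim_col R. (w \<^sub>v* R) $ j \<le> v $ j)
    \<longleftrightarrow> (\<forall>i<dim_row R. w $ i \<le> w_star v R $ i)"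
proof -
  have "(\<forall>j<dim_col R. (w \<^sub>v* R) $ j \<le> v $ j)
    \<longleftrightarrow> (\<forall>i<dim_row R. \<forall>j<dim_col R. w $ i \<le> v $ j \<oslash> R $$ (i, j))"
    by (auto simp: index_row_times_mat sum_gsemi_le_iff times_le_iff_le_gdiv)
  \<comment> \<open>\<open>Min\<close> is characterised by its lower bounds only on nonempty finite
    sets.\<close>
  moreover have "{..<dim_col R} \<noteq> {}"
    using assms(2) by auto
  ultimately show ?thesis
    using assms(1) by (auto simp: w_star_def)
qed

lemma row_times_mat_mono:
  fixes R :: "gsemi mat"
  assumes "\<And>i. i < dim_row R \<Longrightarrow> w $ i \<le> w' $ i" and "j < dim_col R"
  shows "(w \<^sub>v* R) $ j \<le> (w' \<^sub>v* R) $ j"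
proof -
  have "w $ i * R $$ (i, j) \<le> (\<Sum>i<dim_row R. w' $ i * R $$ (i, j))" if "i < dim_row R" for i
  proof -
    have "w $ i * R $$ (i, j) \<le> w' $ i * R $$ (i, j)"
      by (rule times_gsemi_mono) (rule assms(1)[OF that])
    \<comment> \<open>Each summand lies below the sum: the supremum property with the sum itself as
      the bound.\<close>
    also have "\<dots> \<le> (\<Sum>i<dim_row R. w' $ i * R $$ (i, j))"
      using that sum_gsemi_le_iff[of "{..<dim_row R}" "\<lambda>i. w' $ i * R $$ (i, j)"] by blast
    finally show ?thesis .
  qed
  then show ?thesis
    using assms(2) by (simp add: index_row_times_mat sum_gsemi_le_iff)
qed

lemma is_linear_combination_iff_w_star:
  assumes "dim_vec v = dim_col R" and "dim_col R > 0"
  shows "is_linear_combination v R \<longleftrightarrow> v = w_star v R \<^sub>v* R"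
proof
  assume "is_linear_combination v R"
  then obtain w where w: "v = w \<^sub>v* R"
    by (auto simp: is_linear_combination_def)
  \<comment> \<open>Only the half \<open>w \<^sub>v* R \<le> v\<close> of the equality is used here;
    the equality returns in the lower bound, as
    \<open>v = w \<^sub>v* R \<le> w_star v R \<^sub>v* R\<close>.\<close>
  then have le: "w $ i \<le> w_star v R $ i" if "i < dim_row R" for i
    using row_times_mat_le_iff_le_w_star[OF assms, of w] that by simp
  show "v = w_star v R \<^sub>v* R"
  proof (rule eq_vecI)
    show "dim_vec v = dim_vec (w_star v R \<^sub>v* R)"
      using assms(1) by (simp add: row_times_mat_def)
  next
    fix j assume "j < dim_vec (w_star v R \<^sub>v* R)"
    then have j: "j < dim_col R"
      by (simp add: row_times_mat_def)
    show "v $ j = (w_star v R \<^sub>v* R) $ j"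
    proof (rule antisym)
      show "v $ j \<le> (w_star v R \<^sub>v* R) $ j"
        using row_times_mat_mono[OF le j] w by simp
      \<comment> \<open>Residuation applied to \<open>w_star v R\<close> itself, where the
        right-hand side is reflexivity.\<close>
      show "(w_star v R \<^sub>v* R) $ j \<le> v $ j"
        using row_times_mat_le_iff_le_w_star[OF assms, of "w_star v R"] j by simp
    qed
  qed
next
  assume "v = w_star v R \<^sub>v* R"
  moreover have "w_star v R \<in> carrier_vec (dim_row R)"
    by (simp add: w_star_def)
  ultimately show "is_linear_combination v R"
    by (auto simp: is_linear_combination_def)
qed

theorem proposition30:
  fixes p n :: nat
    and A B R :: "gsemi mat" and c d e f v :: "gsemi vec" and g h :: gsemi
  assumes "A \<in> carrier_mat p n" and "elements_mat A \<subseteq> Rmax"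
    and "B \<in> carrier_mat p n"
    and "c \<in> carrier_vec p" and "set\<^sub>v c \<subseteq> Rmax"
    and "d \<in> carrier_vec p"
    and "g \<in> Rmax" and "h \<noteq> PInf"
    and "e \<in> carrier_vec n" and "set\<^sub>v e \<subseteq> Rmax"
    and "f \<in> carrier_vec n"
    and "\<not> (e = 0\<^sub>v n \<and> g = 0)"
    and v: "v = ineq_row e g f h"
    and R: "R = system_mat A c B d"
    and "\<forall>i < p. row R i \<noteq> 0\<^sub>v (2 * n + 2)"
  shows "is_linear_combination v R \<longleftrightarrow> v = w_star v R \<^sub>v* R"
proof (rule is_linear_combination_iff_w_star)
  \<comment> \<open>The two constant terms keep the width positive even for
    \<open>n = 0\<close>.\<close>
  have "dim_vec v = 2 * n + 2"
    using assms(9,11) by (simp add: v ineq_row_def)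
  moreover have "dim_col R = 2 * n + 2"
    using assms(1) by (simp add: R system_mat_def)
  ultimately show "dim_vec v = dim_col R" and "dim_col R > 0"
    by simp_all
qed

end
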